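(* Let $G$ be a finite group and let $S$ denote the set of its cyclic subgroups of prime order. Then the Radon transform is not injective on $G$ if $$\sum_{H\in S}|H|^{-1}<1+\frac{|S|-1}{|G|}.$$
   Context: For $n\ge 2$ let $C_n$ be the cyclic group of order $n$, and let $\Gamma_n$ be the set of nontrivial homomorphisms $C_n\to G$. For $f:G\to\mathbb{C}$, $x\in G$ and $\gamma\in\Gamma_n$ put $R_nf(x,\gamma)=\sum_{t\in C_n}f(x\gamma(t))$. The Radon transform is $Rf=(R_nf)_{n\ge2}$; it is injective on $G$ if the only $f:G\to\mathbb{C}$ with $R_nf=0$ for all $n\ge2$ is $f=0$. *)

theory Defs
  imports Complex_Main "HOL-Algebra.Algebra"
begin

(* C_n is the library's integer_mod_group n, with carrier {0..<int n} for n >= 1.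
   Following HOL-Algebra's hom, homomorphisms are total functions whose values outside the
   carrier of C_n are arbitrary; the transform below does not depend on those values. *)

definition nontrivial_homs :: "nat \<Rightarrow> ('a, 'b) monoid_scheme \<Rightarrow> (int \<Rightarrow> 'a) set" where
  "nontrivial_homs n G =
     {\<gamma> \<in> hom (integer_mod_group n) G. \<not> trivial_homomorphism (integer_mod_group n) G \<gamma>}"

definition radon ::
  "('a, 'b) monoid_scheme \<Rightarrow> nat \<Rightarrow> ('a \<Rightarrow> complex) \<Rightarrow> 'a \<Rightarrow> (int \<Rightarrow> 'a) \<Rightarrow> complex" where
  "radon G n f x \<gamma> = (\<Sum>t \<in> carrier (integer_mod_group n). f (x \<otimes>\<^bsub>G\<^esub> \<gamma> t))"

(* A function on G is a function on the ambient type considered only on carrier G,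
   so vanishing is required on the carrier only. *)

definition radon_injective :: "('a, 'b) monoid_scheme \<Rightarrow> bool" where
  "radon_injective G \<longleftrightarrow>
     (\<forall>f :: 'a \<Rightarrow> complex.
        (\<forall>n\<ge>2. \<forall>x \<in> carrier G. \<forall>\<gamma> \<in> nontrivial_homs n G. radon G n f x \<gamma> = 0)
        \<longrightarrow> (\<forall>x \<in> carrier G. f x = 0))"

definition prime_cyclic_subgroups :: "('a, 'b) monoid_scheme \<Rightarrow> 'a set set" where
  "prime_cyclic_subgroups G =
     {H. subgroup H G \<and> cyclic_group (G\<lparr>carrier := H\<rparr>) \<and> Factorial_Ring.prime (card H)}"

end

theory Submission
  imports Defs
begin

text \<open>
  The Radon transform of \<open>f\<close> vanishes as soon as \<open>f\<close> sums to zero over every left coset of every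
  subgroup of prime order: the image of a nontrivial homomorphism \<open>\<gamma>\<close> on \<open>C\<^sub>n\<close> contains such a
  subgroup \<open>H\<close>, and \<open>|H|\<close> times the value of the transform at \<open>x\<close> and \<open>\<gamma>\<close> is a sum of sums of \<open>f\<close>
  over cosets of \<open>H\<close> (lemmas \<open>prime_cyclic_subgroup_in_nontrivial_subgroup\<close> and \<open>sum_hom_eq_0_if_coset_sums_eq_0\<close>).
  A nonzero \<open>f\<close> with vanishing coset sums is a nonzero solution of a homogeneous linear system with
  one unknown for each element of \<open>G\<close>.

  Counting one equation for each coset gives \<open>\<Sum>\<^sub>H |G|/|H|\<close> equations, which may be \<open>|G|\<close> or more. The cosets
  of each single \<open>H\<close> partition \<open>G\<close>, however, so all \<open>H\<close> share the consequence that \<open>f\<close> sums to zero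
  over \<open>G\<close>. Once this one equation is imposed, the equation of one coset of each \<open>H\<close> becomes
  redundant, here that of \<open>H\<close> itself. What remains are at most \<open>1 + \<Sum>\<^sub>H (|G|/|H| - 1)\<close> equations,
  and the hypothesis, multiplied by \<open>|G|\<close>, says that this number is less than \<open>|G|\<close>.
\<close>

section \<open>Homogeneous linear systems with fewer equations than unknowns\<close>

text \<open>Gaussian elimination: an equation with a nonzero coefficient at \<open>x\<^sub>0\<close> eliminates that unknown,
  leaving one unknown and one equation fewer.\<close>

lemma homogeneous_system_nontrivial_solution:
  fixes c :: "'e \<Rightarrow> 'x \<Rightarrow> 'k::field"
  assumes "finite E" "finite A" "card E < card A"
  shows "\<exists>f. (\<exists>x\<in>A. f x \<noteq> 0) \<and> (\<forall>e\<in>E. (\<Sum>x\<in>A. c e x * f x) = 0)"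
  using assms
proof (induction E arbitrary: A c rule: finite_induct)
  case empty
  then have "A \<noteq> {}" by auto
  then show ?case by (intro exI[of _ "\<lambda>_. 1"]) auto
next
  case (insert e E)
  show ?case
  proof (cases "\<exists>x0\<in>A. c e x0 \<noteq> 0")
    case False
    have "card E < card A" using insert by simp
    with insert.IH[OF insert.prems(1), of c] False show ?thesis by force
  next
    case True
    then obtain x0 where x0: "x0 \<in> A" "c e x0 \<noteq> 0" by blast
    \<comment> \<open>\<open>d\<close> is the system after subtracting from each equation the multiple of equation \<open>e\<close> that
      cancels its \<open>x\<^sub>0\<close> coefficient; \<open>g\<close> extends a solution \<open>f\<close> of it by solving \<open>e\<close> for \<open>x\<^sub>0\<close>.\<close>
    define B where "B = A - {x0}"
    define d where "d e' x = c e' x - c e' x0 * c e x / c e x0" for e' x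
    have "finite B" "card E < card B"
      using insert.prems insert.hyps x0 by (auto simp: B_def)
    then obtain f where f: "\<exists>x\<in>B. f x \<noteq> 0" "\<forall>e'\<in>E. (\<Sum>x\<in>B. d e' x * f x) = 0"
      using insert.IH[of B d] by blast
    define g where "g = f(x0 := - (\<Sum>x\<in>B. c e x * f x) / c e x0)"
    have split: "(\<Sum>x\<in>A. c e' x * g x) = c e' x0 * g x0 + (\<Sum>x\<in>B. c e' x * f x)" for e'
    proof -
      have "(\<Sum>x\<in>A. c e' x * g x) = c e' x0 * g x0 + (\<Sum>x\<in>B. c e' x * g x)"
        unfolding B_def by (rule sum.remove[OF insert.prems(1) x0(1)])
      also have "(\<Sum>x\<in>B. c e' x * g x) = (\<Sum>x\<in>B. c e' x * f x)"
        by (rule sum.cong) (auto simp: g_def B_def)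
      finally show ?thesis .
    qed
    have "(\<Sum>x\<in>A. c e x * g x) = 0"
      using x0 by (simp add: split) (simp add: g_def)
    moreover have "(\<Sum>x\<in>A. c e' x * g x) = 0" if "e' \<in> E" for e'
    proof -
      have "(\<Sum>x\<in>B. d e' x * f x)
          = (\<Sum>x\<in>B. c e' x * f x - c e' x0 / c e x0 * (c e x * f x))"
        by (rule sum.cong) (simp_all add: d_def left_diff_distrib)
      also have "\<dots> = (\<Sum>x\<in>B. c e' x * f x) - c e' x0 / c e x0 * (\<Sum>x\<in>B. c e x * f x)"
        by (simp only: sum_subtractf sum_distrib_left)
      also have "\<dots> = (\<Sum>x\<in>B. c e' x * f x) + c e' x0 * g x0"
        by (simp add: g_def)
      finally show ?thesis using f(2) that by (simp add: split add.commute)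
    qed
    moreover have "\<exists>x\<in>A. g x \<noteq> 0"
      using f(1) by (auto simp: g_def B_def)
    ultimately show ?thesis by blast
  qed
qed

corollary nonzero_function_with_vanishing_sums:
  assumes "finite A" "\<E> \<subseteq> Pow A" "card \<E> < card A"
  obtains f :: "'x \<Rightarrow> 'k::field" where "\<exists>x\<in>A. f x \<noteq> 0" "\<And>B. B \<in> \<E> \<Longrightarrow> sum f B = 0"
proof -
  have "finite \<E>" using assms by (meson finite_Pow_iff finite_subset)
  from homogeneous_system_nontrivial_solution
    [OF this assms(1,3), of "\<lambda>B x. if x \<in> B then 1 else 0 :: 'k"]
  obtain f :: "'x \<Rightarrow> 'k" where f: "\<exists>x\<in>A. f x \<noteq> 0"
    and z: "\<And>B. B \<in> \<E> \<Longrightarrow> (\<Sum>x\<in>A. (if x \<in> B then 1 else 0) * f x) = 0"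
    by blast
  have "sum f B = 0" if "B \<in> \<E>" for B
  proof -
    have "sum f B = (\<Sum>x\<in>A. if x \<in> B then f x else 0)"
      using sum.inter_restrict[OF assms(1), of f B] assms(2) that by (auto simp: Int_absorb1)
    also have "\<dots> = (\<Sum>x\<in>A. (if x \<in> B then 1 else 0) * f x)"
      by (rule sum.cong) auto
    finally show ?thesis using z[OF that] by simp
  qed
  with f that show thesis by blast
qed

section \<open>Radon transform and coset sums\<close>

context group
begin

text \<open>If \<open>p\<close> is a prime factor of the order of \<open>g\<close>, the power of \<open>g\<close> with exponent \<open>ord g / p\<close>
  generates a subgroup of order \<open>p\<close>.\<close>

lemma prime_cyclic_subgroup_in_nontrivial_subgroup:
  assumes fin: "finite (carrier G)" and K: "subgroup K G" and g: "g \<in> K" "g \<noteq> \<one>"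
  obtains H where "H \<in> prime_cyclic_subgroups G" "H \<subseteq> K"
proof -
  have gG: "g \<in> carrier G" using K g by (meson subgroup.mem_carrier)
  have "ord g \<noteq> 1" using ord_eq_1[OF gG] g by simp
  then obtain p where p: "Factorial_Ring.prime p" "p dvd ord g"
    using prime_factor_nat by blast
  have pos: "ord g > 0" using ord_ge_1[OF fin gG] by simp
  define h where "h = g [^] (ord g div p)"
  have hG: "h \<in> carrier G" using gG by (simp add: h_def)
  have "ord h = ord g div (ord g div p)"
    unfolding h_def using p pos gG
    by (intro ord_pow) (simp_all add: div_dvd_iff_mult dvd_div_eq_0_iff)
  also have "\<dots> = p" using p pos by (metis div_div_eq_right dvd_refl div_self mult_1 not_gr0)
  finally have ord: "ord h = p" .
  define H where "H = generate G {h}"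
  have "h \<in> K"
    unfolding h_def using subgroup_int_pow_closed[OF K g(1), of "int (ord g div p)"]
    by (simp add: int_pow_int)
  then have "H \<subseteq> K" unfolding H_def using K by (intro generate_subgroup_incl) auto
  moreover have "card H = p" using generate_pow_card[OF hG] ord by (simp add: H_def)
  moreover have "subgroup H G" unfolding H_def using hG by (intro generate_is_subgroup) auto
  moreover have "cyclic_group (G\<lparr>carrier := H\<rparr>)"
    using cyclic_group_generated[of h] hG by (simp add: subgroup_generated_def H_def)
  ultimately show thesis using that[of H] p by (simp add: prime_cyclic_subgroups_def)
qed

text \<open>For each \<open>h \<in> H\<close>, say \<open>h = \<gamma> s\<close>, translating the summation variable by \<open>s\<close> shows that the
  sum in the conclusion does not change when \<open>h\<close> is inserted on the right. Summing over all
  \<open>h \<in> H\<close> turns each summand into a sum over a left coset of \<open>H\<close>.\<close>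

lemma sum_hom_eq_0_if_coset_sums_eq_0:
  fixes f :: "'a \<Rightarrow> 'k::field_char_0"
  assumes C: "group C" and \<gamma>: "\<gamma> \<in> hom C G"
    and H: "subgroup H G" "finite H" "H \<subseteq> \<gamma> ` carrier C"
    and zero: "\<And>x. x \<in> carrier G \<Longrightarrow> sum f (x <# H) = 0"
    and x: "x \<in> carrier G"
  shows "(\<Sum>t\<in>carrier C. f (x \<otimes> \<gamma> t)) = 0"
proof -
  interpret C: group C by (rule C)
  have \<gamma>G: "\<gamma> t \<in> carrier G" if "t \<in> carrier C" for t
    using \<gamma> that by (auto simp: hom_def)
  have HG: "H \<subseteq> carrier G" using H(1) by (rule subgroup.subset)
  have shift: "(\<Sum>t\<in>carrier C. f (x \<otimes> \<gamma> t \<otimes> h)) = (\<Sum>t\<in>carrier C. f (x \<otimes> \<gamma> t))"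
    if h: "h \<in> H" for h
  proof -
    obtain s where s: "s \<in> carrier C" "h = \<gamma> s" using h H(3) by blast
    have "bij_betw (\<lambda>t. t \<otimes>\<^bsub>C\<^esub> s) (carrier C) (carrier C)"
      using s(1) by (intro bij_betwI[where g = "\<lambda>t. t \<otimes>\<^bsub>C\<^esub> inv\<^bsub>C\<^esub> s"])
        (auto simp: C.m_assoc)
    then have "(\<Sum>t\<in>carrier C. f (x \<otimes> \<gamma> t)) = (\<Sum>t\<in>carrier C. f (x \<otimes> \<gamma> (t \<otimes>\<^bsub>C\<^esub> s)))"
      by (rule sum.reindex_bij_betw[symmetric])
    also have "\<dots> = (\<Sum>t\<in>carrier C. f (x \<otimes> \<gamma> t \<otimes> h))"
      using s x \<gamma>G \<gamma> by (intro sum.cong) (auto simp: hom_mult m_assoc)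
    finally show ?thesis by simp
  qed
  have coset: "(\<Sum>h\<in>H. f (y \<otimes> h)) = 0" if y: "y \<in> carrier G" for y
  proof -
    have "sum f ((\<otimes>) y ` H) = (\<Sum>h\<in>H. f (y \<otimes> h))"
      using y HG by (subst sum.reindex) (auto simp: inj_on_g')
    moreover have "(\<otimes>) y ` H = y <# H" by (auto simp: l_coset_def)
    ultimately show ?thesis using zero[OF y] by simp
  qed
  have "of_nat (card H) * (\<Sum>t\<in>carrier C. f (x \<otimes> \<gamma> t))
      = (\<Sum>h\<in>H. \<Sum>t\<in>carrier C. f (x \<otimes> \<gamma> t \<otimes> h))"
    by (simp add: shift)
  also have "\<dots> = (\<Sum>t\<in>carrier C. \<Sum>h\<in>H. f (x \<otimes> \<gamma> t \<otimes> h))"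
    by (rule sum.swap)
  also have "\<dots> = 0"
    using x \<gamma>G by (simp add: coset)
  finally show ?thesis
    using H(1,2) subgroup.one_closed by fastforce
qed

lemma radon_eq_0_if_coset_sums_eq_0:
  assumes fin: "finite (carrier G)"
    and zero: "\<And>H x. H \<in> prime_cyclic_subgroups G \<Longrightarrow> x \<in> carrier G \<Longrightarrow> sum f (x <# H) = 0"
    and x: "x \<in> carrier G" and \<gamma>: "\<gamma> \<in> nontrivial_homs n G"
  shows "radon G n f x \<gamma> = 0"
proof -
  let ?C = "integer_mod_group n"
  have hom: "\<gamma> \<in> hom ?C G" using \<gamma> by (simp add: nontrivial_homs_def)
  then have img: "subgroup (\<gamma> ` carrier ?C) G"
    by (intro group_hom.img_is_subgroup) (simp add: group_hom_def group_hom_axioms_def is_group)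
  obtain t where t: "t \<in> carrier ?C" "\<gamma> t \<noteq> \<one>"
    using \<gamma> by (auto simp: nontrivial_homs_def trivial_homomorphism_def)
  obtain H where H: "H \<in> prime_cyclic_subgroups G" "H \<subseteq> \<gamma> ` carrier ?C"
    using prime_cyclic_subgroup_in_nontrivial_subgroup[OF fin img _ t(2)] t(1) by blast
  have sub: "subgroup H G" using H(1) by (simp add: prime_cyclic_subgroups_def)
  then have "finite H" using fin by (meson finite_subset subgroup.subset)
  then show ?thesis
    unfolding radon_def using zero[OF H(1)] H(2) sub hom x
    by (intro sum_hom_eq_0_if_coset_sums_eq_0[where H = H]) auto
qed

section \<open>Dependence between the coset equations\<close>

lemma subgroup_in_lcosets:
  assumes "subgroup H G"
  shows "H \<in> lcosets H"
  using lcos_mult_one[OF subgroup.subset[OF assms]] by (force simp: LCOSETS_def)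

text \<open>The left cosets of \<open>H\<close> partition the group, so the equation of one coset follows from those
  of the other cosets and of the whole group. This saves one equation for each \<open>H\<close> in the count.\<close>

lemma sum_subgroup_eq_0_if_other_coset_sums_eq_0:
  fixes f :: "'a \<Rightarrow> 'k::comm_monoid_add"
  assumes fin: "finite (carrier G)" and H: "subgroup H G"
    and total: "sum f (carrier G) = 0"
    and other: "\<And>B. B \<in> lcosets H - {H} \<Longrightarrow> sum f B = 0"
  shows "sum f H = 0"
proof -
  have HL: "H \<in> lcosets H" by (rule subgroup_in_lcosets[OF H])
  have finL: "finite (lcosets H)"
    using fin lcosets_subset_PowG[OF H] by (meson finite_Pow_iff finite_subset)
  have "0 = sum f (\<Union>(lcosets H))" using total lcosets_part_G[OF H] by simp
  also have "\<dots> = sum (sum f) (lcosets H)"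
  proof (rule sum.Union_disjoint[unfolded comp_def])
    show "\<forall>A\<in>lcosets H. finite A"
      using fin lcosets_subset_PowG[OF H] by (meson PowD finite_subset subsetD)
    show "\<forall>A\<in>lcosets H. \<forall>B\<in>lcosets H. A \<noteq> B \<longrightarrow> A \<inter> B = {}"
      using lcos_disjoint[OF H] by blast
  qed
  also have "\<dots> = sum f H + sum (sum f) (lcosets H - {H})"
    by (rule sum.remove[OF finL HL])
  also have "\<dots> = sum f H" using other by simp
  finally show ?thesis by simp
qed

end

section \<open>Counting the equations\<close>

theorem proposition5p5:
  fixes G :: "('a, 'b) monoid_scheme"
  assumes "group G" and "finite (carrier G)"
    and "(\<Sum>H \<in> prime_cyclic_subgroups G. 1 / real (card H))
           < 1 + (real (card (prime_cyclic_subgroups G)) - 1) / real (order G)"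
  shows "\<not> radon_injective G"
proof -
  interpret group G by (rule assms(1))
  note fin = assms(2)
  let ?S = "prime_cyclic_subgroups G"
  let ?N = "real (order G)"
  define \<E> where "\<E> = insert (carrier G) (\<Union>H\<in>?S. lcosets\<^bsub>G\<^esub> H - {H})"
  have sub: "subgroup H G" if "H \<in> ?S" for H
    using that by (simp add: prime_cyclic_subgroups_def)
  have finS: "finite ?S"
    using fin sub by (intro finite_subset[of ?S "Pow (carrier G)"]) (auto dest: subgroup.subset)
  have N: "?N > 0" using fin one_closed by (auto simp: order_def card_gt_0_iff)
  have sub_carrier: "\<E> \<subseteq> Pow (carrier G)"
    using lcosets_subset_PowG[OF sub] by (auto simp: \<E>_def)

  have card_coset_equations: "real (card (lcosets\<^bsub>G\<^esub> H - {H})) = ?N * (1 / real (card H)) - 1"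
    if "H \<in> ?S" for H
  proof -
    have H: "subgroup H G" by (rule sub[OF that])
    have HL: "H \<in> lcosets\<^bsub>G\<^esub> H" by (rule subgroup_in_lcosets[OF H])
    have lagrange: "card (lcosets\<^bsub>G\<^esub> H) * card H = order G" by (rule l_lagrange[OF fin H])
    with N have pos: "card (lcosets\<^bsub>G\<^esub> H) > 0" "card H > 0"
      by (auto intro!: Nat.gr0I)
    have "real (card (lcosets\<^bsub>G\<^esub> H)) = ?N / real (card H)"
      using pos by (simp add: lagrange[symmetric])
    with pos HL show ?thesis by (simp add: of_nat_diff)
  qed
  have "card \<E> \<le> Suc (\<Sum>H\<in>?S. card (lcosets\<^bsub>G\<^esub> H - {H}))"
    unfolding \<E>_def using card_UN_le[OF finS, of "\<lambda>H. lcosets\<^bsub>G\<^esub> H - {H}"]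
    by (intro card_insert_le_m1) auto
  then have "real (card \<E>) \<le> 1 + (\<Sum>H\<in>?S. real (card (lcosets\<^bsub>G\<^esub> H - {H})))"
    by (simp flip: of_nat_sum of_nat_Suc)
  also have "\<dots> = 1 + (?N * (\<Sum>H\<in>?S. 1 / real (card H)) - real (card ?S))"
    by (simp add: card_coset_equations sum_subtractf sum_distrib_left)
  also have "\<dots> < ?N"
  proof -
    have "?N * (1 + (real (card ?S) - 1) / ?N) = ?N + real (card ?S) - 1"
      using N by (simp add: field_simps)
    with mult_strict_left_mono[OF assms(3) N] show ?thesis by linarith
  qed
  finally have "card \<E> < card (carrier G)" by (simp add: order_def)
  then obtain f :: "'a \<Rightarrow> complex"
    where f: "\<exists>x\<in>carrier G. f x \<noteq> 0" and zero: "\<And>B. B \<in> \<E> \<Longrightarrow> sum f B = 0"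
    using nonzero_function_with_vanishing_sums[OF fin sub_carrier] by blast

  have "sum f (x <#\<^bsub>G\<^esub> H) = 0" if H: "H \<in> ?S" and x: "x \<in> carrier G" for H x
  proof (cases "x <#\<^bsub>G\<^esub> H = H")
    case True
    have "sum f H = 0"
      using zero H
      by (intro sum_subgroup_eq_0_if_other_coset_sums_eq_0[OF fin sub[OF H]]) (auto simp: \<E>_def)
    with True show ?thesis by simp
  next
    case False
    with H x have "x <#\<^bsub>G\<^esub> H \<in> \<E>" by (auto simp: \<E>_def LCOSETS_def)
    then show ?thesis by (rule zero)
  qed
  then have "radon G n f x \<gamma> = 0" if "x \<in> carrier G" "\<gamma> \<in> nontrivial_homs n G" for n x \<gamma>
    using radon_eq_0_if_coset_sums_eq_0[OF fin _ that] by blast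
  with f show ?thesis unfolding radon_injective_def by blast
qed

end
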